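(* Let $r\ge 0$ be an integer and $\mu_r\in\mathbb{C}$. Let $\lambda^{t}_{n,m}$ be defined by $P^{t}_n(\mu_r;r)(x)=\sum_{m=0}^{n}\lambda^{t}_{n,m}P_m(x)$. Then: \begin{enumerate} \item For $0\le k\le r$: $P^{t}_{k}(\mu_r;r)(x)=P_k(x)$; that is, $\lambda^{t}_{k,k}=1$ and $\lambda^{t}_{k,m}=0$ for $0\le m\le k-1$. \item For $r+1\le k\le 2r$: $$P^{t}_{k}(\mu_r;r)(x)=P_k(x)-\mu_r\sum_{i=0}^{k-r-1}\frac{1}{4^i}P_{k-2i-1}(x);$$ that is, $\lambda^{t}_{k,k}=1$; $\lambda^{t}_{k,k-2i-1}=-\mu_r/4^i$ and $\lambda^{t}_{k,k-2i-2}=0$ for $0\le i\le k-r-1$; and $\lambda^{t}_{k,m}=0$ for $0\le m\le 2r-k-1$. \item For $n\ge 0$: $$P^{t}_{n+2r+1}(\mu_r;r)(x)=P_{n+2r+1}(x)-\mu_r\sum_{i=0}^{r}\frac{1}{4^i}P_{n+2(r-i)}(x);$$ that is, $\lambda^{t}_{n+2r+1,n+2r+1}=1$; $\lambda^{t}_{n+2r+1,n+2(r-i)}=-\mu_r/4^i$ for $0\le i\le r$; $\lambda^{t}_{n+2r+1,n+2(r-i)-1}=0$ for $0\le i\le r-1$; and $\lambda^{t}_{n+2r+1,m}=0$ for $0\le m\le n-1$. \end{enumerate}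
   Context: $\{P_n\}_{n\ge0}$ denotes the monic Chebyshev polynomials of the second kind: $P_0=1$, $P_1=x$, $P_{n+2}(x)=xP_{n+1}(x)-\frac14P_n(x)$ for $n\ge 0$. For an integer $r\ge 0$ and $\mu_r\in\mathbb{C}$, the $r$th-perturbed sequence by translation $\{P^t_n(\mu_r;r)\}_{n\ge 0}$ is the monic sequence with $P^t_0=1$, $P^t_1(x)=x-\beta_0$, $P^t_{n+2}(x)=(x-\beta_{n+1})P^t_{n+1}(x)-\frac14P^t_n(x)$ for $n\ge 0$, where $\beta_r=\mu_r$ and $\beta_n=0$ for $n\ne r$. Index ranges whose upper bound is smaller than the lower bound are empty. *)

theory Defs
  imports "HOL-Computational_Algebra.Polynomial"
begin

fun monic_cheb_U :: "nat \<Rightarrow> complex poly" where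
  "monic_cheb_U 0 = 1"
| "monic_cheb_U (Suc 0) = [:0, 1:]"
| "monic_cheb_U (Suc (Suc n)) =
     [:0, 1:] * monic_cheb_U (Suc n) - smult (1/4) (monic_cheb_U n)"

definition transl_beta :: "complex \<Rightarrow> nat \<Rightarrow> nat \<Rightarrow> complex" where
  "transl_beta \<mu> r n = (if n = r then \<mu> else 0)"

fun perturbed_cheb_U :: "complex \<Rightarrow> nat \<Rightarrow> nat \<Rightarrow> complex poly" where
  "perturbed_cheb_U \<mu> r 0 = 1"
| "perturbed_cheb_U \<mu> r (Suc 0) = [:- transl_beta \<mu> r 0, 1:]"
| "perturbed_cheb_U \<mu> r (Suc (Suc n)) =
     [:- transl_beta \<mu> r (Suc n), 1:] * perturbed_cheb_U \<mu> r (Suc n)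
       - smult (1/4) (perturbed_cheb_U \<mu> r n)"

text \<open>The coefficient of \<open>P m\<close> in the expansion of \<open>Q n\<close> with respect to
  \<open>P 0, \<dots>, P n\<close>. The coefficient vector is padded with zeros beyond \<open>n\<close> to make it unique;
  it exists and is unique by \<open>connection_coeffs_ex1\<close> below.\<close>

definition connection_coeff ::
    "(nat \<Rightarrow> complex poly) \<Rightarrow> (nat \<Rightarrow> complex poly) \<Rightarrow> nat \<Rightarrow> nat \<Rightarrow> complex" where
  "connection_coeff Q P n =
     (THE c. Q n = (\<Sum>m=0..n. smult (c m) (P m)) \<and> (\<forall>m>n. c m = 0))"

lemma expansion_ex1:
  fixes P :: "nat \<Rightarrow> complex poly"
  assumes P: "\<And>m. degree (P m) = m" "\<And>m. lead_coeff (P m) = 1"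
  shows "degree q \<le> n \<Longrightarrow> \<exists>!c. q = (\<Sum>m=0..n. smult (c m) (P m)) \<and> (\<forall>m>n. c m = 0)"
proof (induction n arbitrary: q)
  case 0
  have P0: "P 0 = 1"
    using degree_eq_zeroE[OF P(1)[of 0]] P(2)[of 0] by (metis degree_pCons_0 coeff_pCons_0 one_pCons)
  obtain a where a: "q = [:a:]"
    using degree_eq_zeroE[of q] 0 by auto
  show ?case
  proof (rule ex1I[of _ "\<lambda>m. if m = 0 then a else 0"])
    fix c assume c: "q = (\<Sum>m=0..0. smult (c m) (P m)) \<and> (\<forall>m>0. c m = 0)"
    then have "c 0 = a" using a P0 by simp
    then show "c = (\<lambda>m. if m = 0 then a else 0)" using c by auto
  qed (use a P0 in simp)
next
  case (Suc n)
  define a where "a = coeff q (Suc n)"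
  define q' where "q' = q - smult a (P (Suc n))"
  have lc: "coeff (P (Suc n)) (Suc n) = 1" using P[of "Suc n"] by simp
  have low: "degree (\<Sum>m=0..n. smult (c m) (P m)) \<le> n" for c
    by (rule degree_sum_le) (auto intro: order_trans[OF degree_smult_le] simp: P(1))
  have d: "degree q' \<le> n"
  proof (rule degree_le, intro allI impI)
    fix i assume i: "n < i"
    show "coeff q' i = 0"
    proof (cases "i = Suc n")
      case True then show ?thesis by (simp add: q'_def a_def lc)
    next
      case False
      then have "Suc n < i" using i by simp
      then show ?thesis using Suc.prems P(1)[of "Suc n"]
        by (simp add: q'_def coeff_eq_0)
    qed
  qed
  let ?R = "\<lambda>c. q' = (\<Sum>m=0..n. smult (c m) (P m)) \<and> (\<forall>m>n. c m = 0)"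
  have ex1: "\<exists>!c. ?R c" by (rule Suc.IH[OF d])
  then obtain c where cR: "?R c" by (rule ex1E)
  have c: "q' = (\<Sum>m=0..n. smult (c m) (P m))" "\<forall>m>n. c m = 0"
    using conjunct1[OF cR] conjunct2[OF cR] .
  have u: "c' = c" if "q' = (\<Sum>m=0..n. smult (c' m) (P m))" "\<forall>m>n. c' m = 0" for c'
  proof -
    have "(THE c. ?R c) = c'"
      by (rule the1_equality[where P = ?R and a = c', OF ex1 conjI[OF that]])
    moreover have "(THE c. ?R c) = c" by (rule the1_equality[where P = ?R, OF ex1 cR])
    ultimately show ?thesis by (rule trans[OF sym])
  qed
  show ?case
  proof (rule ex1I[of _ "c(Suc n := a)"])
    have s: "(\<Sum>m=0..n. smult ((c(Suc n := a)) m) (P m)) = q'"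
      unfolding c(1) by (rule sum.cong) auto
    have "(\<Sum>m=0..Suc n. smult ((c(Suc n := a)) m) (P m)) = q' + smult a (P (Suc n))"
      unfolding sum.atLeast0_atMost_Suc s by (simp only: fun_upd_same)
    also have "\<dots> = q" unfolding q'_def by (rule diff_add_cancel)
    finally show "q = (\<Sum>m=0..Suc n. smult ((c(Suc n := a)) m) (P m))
        \<and> (\<forall>m>Suc n. (c(Suc n := a)) m = 0)"
      using c(2) by auto
  next
    fix e assume e: "q = (\<Sum>m=0..Suc n. smult (e m) (P m)) \<and> (\<forall>m>Suc n. e m = 0)"
    have q: "q = (\<Sum>m=0..n. smult (e m) (P m)) + smult (e (Suc n)) (P (Suc n))"
      using e by simp
    have "coeff (\<Sum>m=0..n. smult (e m) (P m)) (Suc n) = 0"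
      using low[of e] by (intro coeff_eq_0) simp
    then have ea: "e (Suc n) = a" using q lc by (simp add: a_def)
    have "(\<Sum>m=0..n. smult ((e(Suc n := 0)) m) (P m)) = (\<Sum>m=0..n. smult (e m) (P m))"
      by (rule sum.cong) auto
    then have "q' = (\<Sum>m=0..n. smult ((e(Suc n := 0)) m) (P m))"
      using q ea unfolding q'_def by (metis add_diff_cancel_right')
    moreover have "\<forall>m>n. (e(Suc n := 0)) m = 0" using e by auto
    ultimately have "e(Suc n := 0) = c" by (rule u)
    then show "e = c(Suc n := a)" using ea by auto
  qed
qed

lemma monic_three_term_step:
  fixes p q :: "complex poly"
  assumes "degree p = Suc n" "lead_coeff p = 1" "degree q = n"
  shows "degree ([:b, 1:] * p - smult s q) = Suc (Suc n) \<and>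
         lead_coeff ([:b, 1:] * p - smult s q) = 1"
proof -
  have p0: "p \<noteq> 0" using assms by auto
  have 1: "degree ([:b, 1:] * p) = Suc (Suc n)"
    using p0 assms by (subst degree_mult_eq) auto
  have 2: "degree (smult s q) < degree ([:b, 1:] * p)"
    using 1 degree_smult_le[of s q] assms by simp
  have 3: "degree ([:b, 1:] * p - smult s q) = Suc (Suc n)"
    using 1 degree_add_eq_left[of "- smult s q" "[:b, 1:] * p"] 2 by simp
  have "lead_coeff ([:b, 1:] * p) = 1" using assms by (simp only: lead_coeff_mult) simp
  then have "coeff ([:b, 1:] * p) (Suc (Suc n)) = 1" unfolding 1 .
  moreover have "coeff (smult s q) (Suc (Suc n)) = 0" using 1 2 by (intro coeff_eq_0) simp
  ultimately show ?thesis unfolding 3 by (simp only: coeff_diff) simp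
qed

lemma monic_cheb_U_monic:
  "degree (monic_cheb_U n) = n \<and> lead_coeff (monic_cheb_U n) = 1"
proof (induction n rule: monic_cheb_U.induct)
  case (3 n)
  then show ?case unfolding monic_cheb_U.simps by (intro monic_three_term_step) auto
qed simp_all

lemma perturbed_cheb_U_monic:
  "degree (perturbed_cheb_U \<mu> r n) = n \<and> lead_coeff (perturbed_cheb_U \<mu> r n) = 1"
proof (induction \<mu> r n rule: perturbed_cheb_U.induct)
  case (3 \<mu> r n)
  then show ?case unfolding perturbed_cheb_U.simps by (intro monic_three_term_step) auto
qed simp_all

lemma connection_coeffs_ex1:
  "\<exists>!c. perturbed_cheb_U \<mu> r n = (\<Sum>m=0..n. smult (c m) (monic_cheb_U m)) \<and> (\<forall>m>n. c m = 0)"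
  by (rule expansion_ex1)
    (use monic_cheb_U_monic in blast, use monic_cheb_U_monic in blast,
     simp only: perturbed_cheb_U_monic order_refl)

end

theory Submission
  imports Defs
begin

text \<open>Perturbing the recurrence at level \<open>r\<close> adds \<open>-\<mu> P\<^sub>r\<close> to the polynomial of index \<open>r + 1\<close>, and from there
  on the unperturbed recurrence propagates this to \<open>-\<mu> P\<^sub>r P\<^sub>j\<close> at index \<open>r + 1 + j\<close>. Iterating
  \<open>P\<^sub>r\<^sub>+\<^sub>1 P\<^sub>j\<^sub>+\<^sub>1 = P\<^sub>r\<^sub>+\<^sub>j\<^sub>+\<^sub>2 + P\<^sub>r P\<^sub>j / 4\<close> linearizes the product. All three cases of the theorem are
  instances of one expansion with \<open>min (r + 1) (k - r)\<close> correction terms.\<close>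

text \<open>In the induction step the factor \<open>x\<close> from the recurrence of the first
  polynomial is moved onto the second. This leaves an instance of the hypothesis at
  \<open>Suc j\<close>, hence \<open>arbitrary: j\<close>, and the two terms
  \<open>P r * P (Suc j) / 4\<close> cancel.\<close>

lemma monic_cheb_U_mult_Suc:
  "monic_cheb_U (Suc r) * monic_cheb_U (Suc j) =
     monic_cheb_U (Suc (Suc (r + j))) + smult (1/4) (monic_cheb_U r * monic_cheb_U j)"
proof (induction r arbitrary: j)
  case 0
  then show ?case by simp
next
  case (Suc r)
  let ?P = monic_cheb_U and ?X = "[:0, 1:] :: complex poly"
  have "?P (Suc (Suc r)) * ?P (Suc j) =
      ?P (Suc r) * (?X * ?P (Suc j)) - smult (1/4) (?P r * ?P (Suc j))"
    by (simp only: monic_cheb_U.simps left_diff_distrib mult_smult_left mult.left_commute mult.assoc)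
  also have "?X * ?P (Suc j) = ?P (Suc (Suc j)) + smult (1/4) (?P j)"
    by (simp only: monic_cheb_U.simps diff_add_cancel)
  also have "?P (Suc r) * (?P (Suc (Suc j)) + smult (1/4) (?P j)) =
      ?P (Suc r) * ?P (Suc (Suc j)) + smult (1/4) (?P (Suc r) * ?P j)"
    by (simp only: distrib_left mult_smult_right)
  also note Suc.IH[of "Suc j"]
  finally show ?case by simp
qed

lemma smult_sum_right: "smult a (\<Sum>i\<in>A. f i) = (\<Sum>i\<in>A. smult a (f i))"
  by (induction A rule: infinite_finite_induct) (simp_all add: smult_add_right)

text \<open>Each iteration lowers both indices by one and contributes a factor 1/4. It stops when
  the smaller index reaches 0, hence \<open>Suc (min r j)\<close> terms.\<close>

lemma monic_cheb_U_mult: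
  "monic_cheb_U r * monic_cheb_U j =
     (\<Sum>i<Suc (min r j). smult (1 / 4^i) (monic_cheb_U (r + j - 2*i)))"
proof (induction r arbitrary: j)
  case 0
  then show ?case by simp
next
  case (Suc r)
  show ?case
  proof (cases j)
    case 0
    then show ?thesis by simp
  next
    case (Suc l)
    show ?thesis
      \<comment> \<open>The shift splits off the summand \<open>i = 0\<close>, the leading term of
        the product rule; the rest is the hypothesis scaled by 1/4.\<close>
      unfolding Suc monic_cheb_U_mult_Suc Suc.IH min_Suc_Suc
        sum.lessThan_Suc_shift[where n = "Suc (min r l)"]
      by (simp add: smult_sum_right del: sum.lessThan_Suc monic_cheb_U.simps(3))
  qed
qed

lemma perturbed_cheb_U_le:
  "k \<le> r \<Longrightarrow> perturbed_cheb_U \<mu> r k = monic_cheb_U k"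
  by (induction k rule: monic_cheb_U.induct) (auto simp: transl_beta_def)

text \<open>Beyond index \<open>r\<close> all shifts vanish, so both sides obey the same recurrence
  in \<open>j\<close>; it suffices to compare them at \<open>j = 0\<close> and
  \<open>j = 1\<close>.\<close>

lemma perturbed_cheb_U_gt:
  "perturbed_cheb_U \<mu> r (Suc (r + j)) =
     monic_cheb_U (Suc (r + j)) - smult \<mu> (monic_cheb_U r * monic_cheb_U j)"
proof -
  \<comment> \<open>Only here does \<open>\<mu>\<close> enter. The case \<open>r = 0\<close> is
    separate because index 1 has its own defining equation.\<close>
  have base: "perturbed_cheb_U \<mu> r (Suc r) = monic_cheb_U (Suc r) - smult \<mu> (monic_cheb_U r)"
  proof (cases r)
    case 0
    then show ?thesis by (simp add: transl_beta_def)
  next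
    case (Suc s)
    then show ?thesis
      by (simp add: transl_beta_def perturbed_cheb_U_le algebra_simps)
  qed
  show ?thesis
  proof (induction j rule: monic_cheb_U.induct)
    case 1
    then show ?case by (simp only: base monic_cheb_U.simps(1) add_0_right mult_1_right)
  next
    case 2
    have "perturbed_cheb_U \<mu> r (Suc (r + Suc 0)) =
        [:0, 1:] * perturbed_cheb_U \<mu> r (Suc r) - smult (1/4) (perturbed_cheb_U \<mu> r r)"
      by (simp add: transl_beta_def)
    then show ?case
      by (simp add: base perturbed_cheb_U_le algebra_simps smult_diff_right)
  next
    case (3 j)
    have "perturbed_cheb_U \<mu> r (Suc (r + Suc (Suc j))) =
        [:0, 1:] * perturbed_cheb_U \<mu> r (Suc (r + Suc j))
          - smult (1/4) (perturbed_cheb_U \<mu> r (Suc (r + j)))"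
      by (simp add: transl_beta_def)
    also have "\<dots> = ([:0, 1:] * monic_cheb_U (Suc (r + Suc j)) - smult (1/4) (monic_cheb_U (Suc (r + j))))
        - smult \<mu> (monic_cheb_U r * ([:0, 1:] * monic_cheb_U (Suc j) - smult (1/4) (monic_cheb_U j)))"
      unfolding 3 by (simp only: algebra_simps smult_diff_right mult_smult_right mult_smult_left smult_smult)
    finally show ?case by simp
  qed
qed

text \<open>For \<open>k \<le> r\<close> truncated subtraction makes the sum empty, so one formula
  covers every \<open>k\<close>.\<close>

lemma perturbed_cheb_U_expansion:
  "perturbed_cheb_U \<mu> r k = monic_cheb_U k
     - smult \<mu> (\<Sum>i<min (Suc r) (k - r). smult (1 / 4^i) (monic_cheb_U (k - 2*i - 1)))"
proof (cases "k \<le> r")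
  case True
  then show ?thesis by (simp add: perturbed_cheb_U_le)
next
  case False
  then obtain j where k: "k = Suc (r + j)"
    using less_iff_Suc_add[of r k] by auto
  have "min (Suc r) (k - r) = Suc (min r j)" unfolding k by simp
  moreover have "k - 2*i - 1 = r + j - 2*i" for i unfolding k by simp
  ultimately show ?thesis
    unfolding k perturbed_cheb_U_gt monic_cheb_U_mult by simp
qed

lemma connection_coeff_perturbed_eqI:
  assumes "perturbed_cheb_U \<mu> r n = (\<Sum>m=0..n. smult (c m) (monic_cheb_U m))"
    and "\<And>m. n < m \<Longrightarrow> c m = 0"
  shows "connection_coeff (perturbed_cheb_U \<mu> r) monic_cheb_U n = c"
  unfolding connection_coeff_def
  by (rule the1_equality[OF connection_coeffs_ex1]) (use assms in auto)

text \<open>The exponent \<open>(k - m - 1) div 2\<close> recovers \<open>i\<close> from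
  \<open>m = k - 2*i - 1\<close>.\<close>

lemma connection_coeff_perturbed:
  "connection_coeff (perturbed_cheb_U \<mu> r) monic_cheb_U k m =
     (if m = k then 1
      else if \<exists>i<min (Suc r) (k - r). m = k - 2*i - 1 then - \<mu> / 4 ^ ((k - m - 1) div 2)
      else 0)"
proof -
  define I where "I = {..<min (Suc r) (k - r)}"
  define f where "f i = k - 2*i - 1" for i
  define b where "b = (\<lambda>m. - \<mu> / 4 ^ ((k - m - 1) div 2))"
  define c where "c = (\<lambda>m. if m = k then 1 else if m \<in> f ` I then b m else 0)"
  \<comment> \<open>Adding \<open>i \<le> r\<close> and \<open>i \<le> k - r - 1\<close> gives
    \<open>2*i + 1 \<le> k\<close>, so the subtraction in \<open>f\<close> is exact on
    \<open>I\<close>.\<close>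
  have inj: "inj_on f I" and lt: "f ` I \<subseteq> {..<k}" by (auto simp: inj_on_def I_def f_def)
  have b: "b (f i) = - \<mu> / 4 ^ i" if "i \<in> I" for i
  proof -
    have "k - f i - 1 = 2 * i" using that by (auto simp: I_def f_def)
    then show ?thesis by (simp add: b_def)
  qed
  have "perturbed_cheb_U \<mu> r k = monic_cheb_U k + (\<Sum>i\<in>I. smult (b (f i)) (monic_cheb_U (f i)))"
    unfolding perturbed_cheb_U_expansion I_def[symmetric] f_def[symmetric]
    by (simp add: b smult_sum_right sum_negf)
  also have "(\<Sum>i\<in>I. smult (b (f i)) (monic_cheb_U (f i))) = (\<Sum>m\<in>f ` I. smult (b m) (monic_cheb_U m))"
    by (simp add: sum.reindex[OF inj])
  also have "\<dots> = (\<Sum>m<k. smult (c m) (monic_cheb_U m))"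
    using lt by (intro sum.mono_neutral_cong_left) (auto simp: c_def)
  also have "monic_cheb_U k + \<dots> = (\<Sum>m=0..k. smult (c m) (monic_cheb_U m))"
    by (simp add: c_def atLeast0AtMost flip: lessThan_Suc_atMost)
  finally have "connection_coeff (perturbed_cheb_U \<mu> r) monic_cheb_U k = c"
    using lt by (intro connection_coeff_perturbed_eqI) (auto simp: c_def)
  then show ?thesis by (auto simp: c_def b_def f_def I_def)
qed

theorem proposition3p5:
  fixes r :: nat and \<mu> :: complex
  defines "P \<equiv> monic_cheb_U"
    and "Pt \<equiv> perturbed_cheb_U \<mu> r"
    and "lam \<equiv> connection_coeff (perturbed_cheb_U \<mu> r) monic_cheb_U"
  shows
    "(\<forall>k\<le>r. Pt k = P k \<and> lam k k = 1 \<and> (\<forall>m<k. lam k m = 0))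
   \<and> (\<forall>k. r + 1 \<le> k \<and> k \<le> 2*r \<longrightarrow>
         Pt k = P k - smult \<mu> (\<Sum>i=0..k-r-1. smult (1 / 4^i) (P (k-2*i-1)))
       \<and> lam k k = 1
       \<and> (\<forall>i\<le>k-r-1. lam k (k-2*i-1) = - \<mu> / 4^i \<and> lam k (k-2*i-2) = 0)
       \<and> (\<forall>m<2*r-k. lam k m = 0))
   \<and> (\<forall>n. Pt (n+2*r+1) = P (n+2*r+1) - smult \<mu> (\<Sum>i=0..r. smult (1 / 4^i) (P (n+2*(r-i))))
       \<and> lam (n+2*r+1) (n+2*r+1) = 1
       \<and> (\<forall>i\<le>r. lam (n+2*r+1) (n+2*(r-i)) = - \<mu> / 4^i)
       \<and> (\<forall>i<r. lam (n+2*r+1) (n+2*(r-i)-1) = 0)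
       \<and> (\<forall>m<n. lam (n+2*r+1) m = 0))"
proof (intro conjI allI impI)
  have lam: "lam k m = (if m = k then 1
      else if \<exists>i<min (Suc r) (k - r). m = k - 2*i - 1 then - \<mu> / 4 ^ ((k - m - 1) div 2) else 0)"
    for k m unfolding lam_def by (rule connection_coeff_perturbed)
  show "lam k k = 1" "lam k k = 1" "lam (n+2*r+1) (n+2*r+1) = 1" for k n
    by (simp_all add: lam)
  have lam_hit: "lam k (k - 2*i - 1) = - \<mu> / 4 ^ i" if "i \<le> r" "i < k - r" for k i
  proof -
    have "k - (k - 2*i - 1) - 1 = 2 * i" "k - 2*i - 1 \<noteq> k" using that by auto
    moreover have "i < min (Suc r) (k - r)" using that by simp
    then have "\<exists>l<min (Suc r) (k - r). k - 2*i - 1 = k - 2*l - 1" by blast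
    ultimately show ?thesis unfolding lam by simp
  qed
  have lam_miss: "lam k m = 0" if "m < k" "\<And>i. i \<le> r \<Longrightarrow> i < k - r \<Longrightarrow> m \<noteq> k - 2*i - 1" for k m
  proof -
    have "\<not> (\<exists>i<min (Suc r) (k - r). m = k - 2*i - 1)" using that(2) by auto
    then show ?thesis using less_imp_neq[OF that(1)] unfolding lam by (simp only: if_False)
  qed
  show "Pt k = P k" if "k \<le> r" for k
    using that by (simp add: Pt_def P_def perturbed_cheb_U_le)
  show "lam k m = 0" if "k \<le> r" "m < k" for k m
    using that by (intro lam_miss) auto
  show "Pt k = P k - smult \<mu> (\<Sum>i=0..k-r-1. smult (1 / 4^i) (P (k-2*i-1)))"
    if "r + 1 \<le> k \<and> k \<le> 2*r" for k
  proof -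
    \<comment> \<open>Here \<open>k \<le> 2*r\<close> makes \<open>k - r\<close> the smaller
      bound.\<close>
    have "{..<min (Suc r) (k - r)} = {0..k-r-1}" using that by auto
    then show ?thesis unfolding Pt_def P_def by (simp only: perturbed_cheb_U_expansion)
  qed
  show "lam k (k-2*i-1) = - \<mu> / 4^i" if "r + 1 \<le> k \<and> k \<le> 2*r" "i \<le> k-r-1" for k i
    using that by (intro lam_hit) auto
  show "lam k (k-2*i-2) = 0" if "r + 1 \<le> k \<and> k \<le> 2*r" "i \<le> k-r-1" for k i
  proof (rule lam_miss)
    show "k-2*i-2 \<noteq> k-2*l-1" if "l \<le> r" "l < k - r" for l
    proof -
      \<comment> \<open>Both subtractions are exact, the first because \<open>k \<le> 2*r\<close>,
        so equality would contradict parity.\<close>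
      have "2*i + 2 \<le> k" "2*l + 1 \<le> k"
        using \<open>r + 1 \<le> k \<and> k \<le> 2*r\<close> \<open>i \<le> k-r-1\<close> that by linarith+
      moreover have "2*i + 2 \<noteq> 2*l + 1" by presburger
      ultimately show ?thesis by linarith
    qed
  qed (use that in auto)
  \<comment> \<open>The lowest correction index is \<open>2*r - k + 1\<close>, reached at
    \<open>i = k - r - 1\<close>.\<close>
  show "lam k m = 0" if "r + 1 \<le> k \<and> k \<le> 2*r" "m < 2*r-k" for k m
    using that by (intro lam_miss) auto
  show "Pt (n+2*r+1) = P (n+2*r+1) - smult \<mu> (\<Sum>i=0..r. smult (1 / 4^i) (P (n+2*(r-i))))" for n
  proof -
    \<comment> \<open>Now \<open>k - r = n + r + 1\<close>, so \<open>Suc r\<close> is the smaller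
      bound.\<close>
    have "(\<Sum>i<min (Suc r) (n+2*r+1-r). smult (1 / 4^i) (monic_cheb_U (n+2*r+1-2*i-1))) =
        (\<Sum>i=0..r. smult (1 / 4^i) (monic_cheb_U (n+2*(r-i))))"
      by (intro sum.cong) (auto simp: diff_mult_distrib2)
    then show ?thesis unfolding Pt_def P_def by (simp only: perturbed_cheb_U_expansion)
  qed
  show "lam (n+2*r+1) (n+2*(r-i)) = - \<mu> / 4^i" if "i \<le> r" for n i
  proof -
    have "n+2*(r-i) = n+2*r+1 - 2*i - 1" using that by simp
    then show ?thesis using that by (simp only:) (intro lam_hit; simp)
  qed
  show "lam (n+2*r+1) (n+2*(r-i)-1) = 0" if "i < r" for n i
  proof (rule lam_miss)
    show "n+2*(r-i)-1 \<noteq> n+2*r+1-2*l-1" if "l \<le> r" for l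
    proof -
      \<comment> \<open>Parity again; \<open>i < r\<close> keeps the left subtraction exact.\<close>
      have "n+2*(r-i)-1 + 2*i + 1 = n + 2*r" "n+2*r+1-2*l-1 + 2*l = n + 2*r"
        using \<open>i < r\<close> that by linarith+
      moreover have "2*i + 1 \<noteq> 2*l" by presburger
      ultimately show ?thesis by linarith
    qed
  qed (use that in auto)
  \<comment> \<open>The lowest correction index is \<open>n\<close>, reached at
    \<open>i = r\<close>.\<close>
  show "lam (n+2*r+1) m = 0" if "m < n" for n m
    using that by (intro lam_miss) auto
qed

end
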